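(* Let $\mathcal T=(\mathbb T,\mathcal V,\xi)$ be a topological theory with $\bot\neq k$ in $\mathcal V$ and $T1=1$. For every $\mathcal T$-category $X=(X,a)$, the $\mathcal T$-graph $\mathcal V^X$ is dualisable.
   Context: **Theory.** A topological theory $\mathcal T=(\mathbb T,\mathcal V,\xi)$ consists of a monad $\mathbb T=(T,e,m)$ on $\mathsf{Set}$, a commutative unital quantale $\mathcal V=(\mathcal V,\otimes,k)$ (complete lattice, commutative monoid, $\otimes$ preserves suprema in each variable; $x\otimes y\le z\iff x\le\hom(y,z)$) and a map $\xi:T\mathcal V\to\mathcal V$ such that (a) $T$ preserves weak pullbacks and every naturality square of $m$ is a weak pullback; (b) $(\mathcal V,\xi)$ is an Eilenberg–Moore $\mathbb T$-algebra, $\xi\cdot T(\otimes)=\otimes\cdot\langle\xi\cdot T\pi_1,\xi\cdot T\pi_2\rangle$ on $T(\mathcal V\times\mathcal V)$, and $\xi\cdot T(k)$ is constant $k$ on $T1$ (with $k:1\to\mathcal V$); (c) for every map $f:X\to Y$ and $\varphi:X\to\mathcal V$, $\xi\cdot T(f_!\varphi)=(Tf)_!(\xi\cdot T\varphi)$, where $f_!\varphi(y)=\bigvee_{f(x)=y}\varphi(x)$. **Relations.** A $\mathcal V$-relation $r:X\nrightarrow Y$ is a map $X\times Y\to\mathcal V$, ordered pointwise; $(s\cdot r)(x,z)=\bigvee_y r(x,y)\otimes s(y,z)$; $r^\circ(y,x)=r(x,y)$; a map $f$ is identified with the relation with value $k$ if $f(x)=y$ and $\bot$ otherwise. $T_\xi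 r:TX\nrightarrow TY$ is $T_\xi r(\mathfrak x,\mathfrak y)=\bigvee\{\xi\cdot Tr(\mathfrak w)\mid \mathfrak w\in T(X\times Y),T\pi_1(\mathfrak w)=\mathfrak x,T\pi_2(\mathfrak w)=\mathfrak y\}$. **$\mathcal T$-graphs.** A $\mathcal T$-graph is $(X,a)$ with $a:TX\nrightarrow X$ and $e_X^\circ\le a$; it is a $\mathcal T$-category if moreover $a\cdot T_\xi a\cdot m_X^\circ\le a$. A $\mathcal T$-functor $f:(X,a)\to(Y,b)$ is a map with $a(\mathfrak x,x)\le b(Tf(\mathfrak x),f(x))$ for all $\mathfrak x\in TX$, $x\in X$. A $\mathcal T$-graph $(X,a)$ is dualisable if $a_0=a\cdot e_X$ is transitive ($a_0\cdot a_0\le a_0$) and $a=a_0\cdot\alpha$ for some map $\alpha:TX\to X$. **Exponential.** $\mathcal V$ is a $\mathcal T$-category with structure $(\mathfrak v,v)\mapsto\hom(\xi(\mathfrak v),v)$. $\mathcal V^X$ is the set of $\mathcal T$-functors $X\to\mathcal V$ with the $\mathcal T$-graph structure $$d(\mathfrak p,h)=\bigwedge_{\substack{\mathfrak q\in T(\mathcal V^X\times X),\ x\in X\\ T\pi_1(\mathfrak q)=\mathfrak p}}\hom\bigl(a(T\pi_2(\mathfrak q),x),\hom(\xi\cdot T\mathrm{ev}(\mathfrak q),h(x))\bigr),$$ where $\mathrm{ev}:\mathcal V^X\times X\to\mathcal V$, $(h,x)\mapsto h(x)$. *)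

theory Defs
  imports Main "HOL-Library.FuncSet"
begin

section \<open>The category of sets\<close>

text \<open>
  A functor on the category of all sets cannot be quantified over in HOL if the objects are types.
  The objects are therefore the elements of a type satisfying the axioms of ZF in second-order form
  (Replacement is stated for all HOL functions), \<open>elts x\<close> being the set of members of \<open>x\<close>.
  Infinity is not imposed, so that the hereditarily finite sets are admitted as well.
\<close>

class set_universe =
  fixes elts :: "'a \<Rightarrow> 'a set"
  assumes extensionality: "elts x = elts y \<Longrightarrow> x = y"
    and foundation: "wf {(x, y). x \<in> elts y}"
    and union: "\<exists>z. elts z = (\<Union>y\<in>elts x. elts y)"
    and power: "\<exists>z. elts z = {y. elts y \<subseteq> elts x}"
    and replacement: "\<exists>z. elts z = f ` elts x"

text \<open>\<open>mk A\<close> is meaningful only if \<open>A\<close> is the extension of some element; this is established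
  below for every use that is made of it.\<close>

definition mk :: "'u::set_universe set \<Rightarrow> 'u" where
  "mk A = (THE x. elts x = A)"

definition pair :: "'u::set_universe \<Rightarrow> 'u \<Rightarrow> 'u" where
  "pair x y = mk {mk {x}, mk {x, y}}"

definition ufst :: "'u::set_universe \<Rightarrow> 'u" where
  "ufst p = (THE x. \<exists>y. p = pair x y)"

definition usnd :: "'u::set_universe \<Rightarrow> 'u" where
  "usnd p = (THE y. \<exists>x. p = pair x y)"

definition uprod :: "'u::set_universe \<Rightarrow> 'u \<Rightarrow> 'u" where
  "uprod X Y = mk {pair x y | x y. x \<in> elts X \<and> y \<in> elts Y}"

definition uone :: "'u::set_universe" where
  "uone = mk {mk {}}"

definition ugraph :: "'u::set_universe \<Rightarrow> ('u \<Rightarrow> 'u) \<Rightarrow> 'u" where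
  "ugraph X f = mk ((\<lambda>x. pair x (f x)) ` elts X)"

definition uapp :: "'u::set_universe \<Rightarrow> 'u \<Rightarrow> 'u" where
  "uapp h x = (THE y. pair x y \<in> elts h)"

text \<open>The arrows \<open>X \<rightarrow> Y\<close> are the HOL functions in \<open>elts X \<rightarrow> elts Y\<close>, two of them being
  identified if they agree on \<open>elts X\<close>.\<close>

definition weak_pullback ::
  "'u::set_universe \<Rightarrow> 'u \<Rightarrow> 'u \<Rightarrow> 'u \<Rightarrow> ('u \<Rightarrow> 'u) \<Rightarrow> ('u \<Rightarrow> 'u) \<Rightarrow> ('u \<Rightarrow> 'u) \<Rightarrow> ('u \<Rightarrow> 'u) \<Rightarrow> bool"
where
  "weak_pullback P A B C p q f g \<longleftrightarrow>
     p \<in> elts P \<rightarrow> elts A \<and> q \<in> elts P \<rightarrow> elts B \<and>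
     f \<in> elts A \<rightarrow> elts C \<and> g \<in> elts B \<rightarrow> elts C \<and>
     (\<forall>z\<in>elts P. f (p z) = g (q z)) \<and>
     (\<forall>Q::'u. \<forall>u \<in> elts Q \<rightarrow> elts A. \<forall>v \<in> elts Q \<rightarrow> elts B.
        (\<forall>z\<in>elts Q. f (u z) = g (v z)) \<longrightarrow>
        (\<exists>w \<in> elts Q \<rightarrow> elts P. \<forall>z\<in>elts Q. p (w z) = u z \<and> q (w z) = v z))"

lemma elts_mk: "elts z = A \<Longrightarrow> elts (mk A) = A"
  unfolding mk_def by (rule theI[of "\<lambda>x. elts x = A"]) (auto intro: extensionality)

lemma ex_elts_empty: "\<exists>z::'u::set_universe. elts z = {}"
proof -
  obtain z :: 'u where "\<And>y. (y, z) \<in> {(x, y). x \<in> elts y} \<Longrightarrow> y \<notin> UNIV"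
    using wfE_min[OF foundation UNIV_I] by blast
  then have "elts z = {}" by auto
  then show ?thesis ..
qed

lemma ex_elts_subset:
  fixes x :: "'u::set_universe"
  assumes "A \<subseteq> elts x"
  shows "\<exists>z. elts z = A"
proof (cases "A = {}")
  case True
  then show ?thesis using ex_elts_empty by simp
next
  case False
  then obtain a where "a \<in> A" by blast
  then have "(\<lambda>y. if y \<in> A then y else a) ` elts x = A" using assms by auto
  then show ?thesis using replacement[of "\<lambda>y. if y \<in> A then y else a" x] by simp
qed

lemma ex_elts_doubleton: "\<exists>z::'u::set_universe. elts z = {x, y}"
proof -
  obtain o0 :: 'u where o0: "elts o0 = {}" using ex_elts_empty by blast
  obtain o1 :: 'u where o1: "elts o1 = {y. elts y \<subseteq> elts o0}" using power by blast
  have "elts y = {} \<longleftrightarrow> y = o0" for y :: 'u using extensionality[of y o0] o0 by auto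
  then have o1': "elts o1 = {o0}" unfolding o1 o0 by simp
  obtain o2 :: 'u where o2: "elts o2 = {y. elts y \<subseteq> elts o1}" using power by blast
  have "{o0, o1} \<subseteq> elts o2" using o0 o2 by auto
  then obtain t where t: "elts t = {o0, o1}" using ex_elts_subset by blast
  have "o0 \<noteq> o1" using o0 o1' by auto
  then have "(\<lambda>z. if z = o0 then x else y) ` elts t = {x, y}" using t by auto
  then show ?thesis using replacement[of "\<lambda>z. if z = o0 then x else y" t] by simp
qed

lemma elts_mk_doubleton [simp]: "elts (mk {x, y}) = {x, y}"
proof -
  obtain z where "elts z = {x, y}" using ex_elts_doubleton by blast
  then show ?thesis by (rule elts_mk)
qed

lemma elts_mk_singleton [simp]: "elts (mk {x}) = {x}"
  using elts_mk_doubleton[of x x] by simp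

lemma elts_mk_empty [simp]: "elts (mk {}) = {}"
proof -
  obtain z :: 'a where "elts z = {}" using ex_elts_empty by blast
  then show ?thesis by (rule elts_mk)
qed

lemma elts_uone: "elts uone = {mk {}}"
  by (simp add: uone_def)

lemma elts_pair: "elts (pair x y) = {mk {x}, mk {x, y}}"
  by (simp add: pair_def)

lemma pair_inject [simp]: "pair x y = pair x' y' \<longleftrightarrow> x = x' \<and> y = y'"
proof
  assume "pair x y = pair x' y'"
  then have "{mk {x}, mk {x, y}} = {mk {x'}, mk {x', y'}}" by (metis elts_pair)
  then have "elts ` {mk {x}, mk {x, y}} = elts ` {mk {x'}, mk {x', y'}}" by (rule arg_cong)
  then have "{{x}, {x, y}} = {{x'}, {x', y'}}" by simp
  then show "x = x' \<and> y = y'" by (auto simp: doubleton_eq_iff)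
qed simp

lemma ufst_pair [simp]: "ufst (pair x y) = x"
  by (simp add: ufst_def)

lemma usnd_pair [simp]: "usnd (pair x y) = y"
  by (simp add: usnd_def)

lemma elts_uprod: "elts (uprod X Y) = {pair x y | x y. x \<in> elts X \<and> y \<in> elts Y}"
proof -
  have "\<exists>z. elts z = pair x ` elts Y" for x using replacement by blast
  then have "\<exists>f. \<forall>x. elts (f x) = pair x ` elts Y" by (intro choice allI)
  then obtain f where f: "\<And>x. elts (f x) = pair x ` elts Y" by blast
  obtain z where z: "elts z = f ` elts X" using replacement by blast
  obtain w where "elts w = (\<Union>y\<in>elts z. elts y)" using union by blast
  then have "elts w = {pair x y | x y. x \<in> elts X \<and> y \<in> elts Y}" using f z by auto
  then show ?thesis unfolding uprod_def by (rule elts_mk)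
qed

lemma elts_ugraph: "elts (ugraph X f) = (\<lambda>x. pair x (f x)) ` elts X"
proof -
  obtain z where "elts z = (\<lambda>x. pair x (f x)) ` elts X" using replacement by blast
  then show ?thesis unfolding ugraph_def by (rule elts_mk)
qed

lemma uapp_ugraph: "x \<in> elts X \<Longrightarrow> uapp (ugraph X f) x = f x"
  unfolding uapp_def elts_ugraph by (rule the_equality) auto

lemma elts_mk_ugraphs:
  assumes "F \<subseteq> elts X \<rightarrow> elts Y"
  shows "elts (mk (ugraph X ` F)) = ugraph X ` F"
proof -
  obtain z where z: "elts z = {y. elts y \<subseteq> elts (uprod X Y)}" using power by blast
  have "elts (ugraph X f) \<subseteq> elts (uprod X Y)" if "f \<in> F" for f
    using that assms by (auto simp: elts_ugraph elts_uprod)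
  then have "ugraph X ` F \<subseteq> elts z" using z by blast
  then obtain w where "elts w = ugraph X ` F" using ex_elts_subset by blast
  then show ?thesis by (rule elts_mk)
qed


section \<open>Monads, quantales and topological theories\<close>

text \<open>The action of the functor on arrows takes the domain and the codomain as arguments.\<close>

record 'u set_monad =
  Tob :: "'u \<Rightarrow> 'u"
  Tmap :: "'u \<Rightarrow> 'u \<Rightarrow> ('u \<Rightarrow> 'u) \<Rightarrow> 'u \<Rightarrow> 'u"
  munit :: "'u \<Rightarrow> 'u \<Rightarrow> 'u"
  mmult :: "'u \<Rightarrow> 'u \<Rightarrow> 'u"

locale monad_on_sets =
  fixes M :: "('u::set_universe, 'b) set_monad_scheme"
  assumes Tmap_in: "f \<in> elts X \<rightarrow> elts Y \<Longrightarrow> Tmap M X Y f \<in> elts (Tob M X) \<rightarrow> elts (Tob M Y)"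
    and Tmap_cong: "\<lbrakk>f \<in> elts X \<rightarrow> elts Y; \<And>x. x \<in> elts X \<Longrightarrow> f x = g x; t \<in> elts (Tob M X)\<rbrakk>
      \<Longrightarrow> Tmap M X Y f t = Tmap M X Y g t"
    and Tmap_id: "t \<in> elts (Tob M X) \<Longrightarrow> Tmap M X X id t = t"
    and Tmap_comp: "\<lbrakk>f \<in> elts X \<rightarrow> elts Y; g \<in> elts Y \<rightarrow> elts Z; t \<in> elts (Tob M X)\<rbrakk>
      \<Longrightarrow> Tmap M X Z (g \<circ> f) t = Tmap M Y Z g (Tmap M X Y f t)"
    and munit_in: "munit M X \<in> elts X \<rightarrow> elts (Tob M X)"
    and munit_natural: "\<lbrakk>f \<in> elts X \<rightarrow> elts Y; x \<in> elts X\<rbrakk>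
      \<Longrightarrow> Tmap M X Y f (munit M X x) = munit M Y (f x)"
    and mmult_in: "mmult M X \<in> elts (Tob M (Tob M X)) \<rightarrow> elts (Tob M X)"
    and mmult_natural: "\<lbrakk>f \<in> elts X \<rightarrow> elts Y; t \<in> elts (Tob M (Tob M X))\<rbrakk>
      \<Longrightarrow> Tmap M X Y f (mmult M X t) = mmult M Y (Tmap M (Tob M X) (Tob M Y) (Tmap M X Y f) t)"
    and mmult_munit: "t \<in> elts (Tob M X) \<Longrightarrow> mmult M X (munit M (Tob M X) t) = t"
    and mmult_Tmap_munit:
      "t \<in> elts (Tob M X) \<Longrightarrow> mmult M X (Tmap M X (Tob M X) (munit M X) t) = t"
    and mmult_assoc: "t \<in> elts (Tob M (Tob M (Tob M X)))
      \<Longrightarrow> mmult M X (mmult M (Tob M X) t) =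
          mmult M X (Tmap M (Tob M (Tob M X)) (Tob M X) (mmult M X) t)"

text \<open>The tensor product is \<open>*\<close> and its unit \<open>k\<close> is \<open>1\<close>.\<close>

class comm_quantale = complete_lattice + comm_monoid_mult +
  assumes times_Sup: "x * Sup A = (SUP y\<in>A. x * y)"

definition qhom :: "'v::comm_quantale \<Rightarrow> 'v \<Rightarrow> 'v" where
  "qhom y z = Sup {x. x * y \<le> z}"

lemma qhom_adjoint: "x * y \<le> z \<longleftrightarrow> x \<le> qhom y z"
proof
  assume "x \<le> qhom y z"
  have mono: "y * u \<le> y * w" if "u \<le> w" for u w :: 'a
  proof -
    have "y * w = sup (y * u) (y * w)"
      using times_Sup[of y "{u, w}"] sup_absorb2[OF that] by simp
    then show ?thesis by (metis sup_ge1)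
  qed
  have "x * y \<le> qhom y z * y" using mono[OF \<open>x \<le> qhom y z\<close>] by (simp add: mult.commute)
  also have "\<dots> = (SUP x\<in>{x. x * y \<le> z}. y * x)"
    unfolding qhom_def mult.commute[of _ y] times_Sup ..
  also have "\<dots> \<le> z" by (rule SUP_least) (simp add: mult.commute)
  finally show "x * y \<le> z" .
qed (auto simp: qhom_def intro: Sup_upper)

text \<open>The quantale is a type \<open>'v\<close>; to apply the functor to it, its elements are listed by a bijection
  \<open>vcode\<close> onto the members of an object \<open>Vob\<close>. Under this bijection, the map \<open>xi\<close> is an arrow from
  \<open>Tob Vob\<close> to \<open>Vob\<close>.\<close>

record ('u, 'v) top_theory = "'u set_monad" +
  Vob :: 'u
  vcode :: "'v \<Rightarrow> 'u"
  xi :: "'u \<Rightarrow> 'v"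

definition vdecode :: "('u, 'v) top_theory \<Rightarrow> 'u \<Rightarrow> 'v" where
  "vdecode \<T> = inv (vcode \<T>)"

text \<open>\<open>xiT \<T> X \<phi>\<close> is the composite of \<open>\<xi>\<close> with \<open>T \<phi>\<close>, for \<open>\<phi> : X \<rightarrow> V\<close>.\<close>

definition xiT :: "('u, 'v) top_theory \<Rightarrow> 'u \<Rightarrow> ('u \<Rightarrow> 'v) \<Rightarrow> 'u \<Rightarrow> 'v" where
  "xiT \<T> X \<phi> t = xi \<T> (Tmap \<T> X (Vob \<T>) (vcode \<T> \<circ> \<phi>) t)"

definition shriek ::
  "'u::set_universe \<Rightarrow> ('u \<Rightarrow> 'u) \<Rightarrow> ('u \<Rightarrow> 'v::comm_quantale) \<Rightarrow> 'u \<Rightarrow> 'v" where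
  "shriek X f \<phi> y = (SUP x\<in>{x \<in> elts X. f x = y}. \<phi> x)"

locale topological_theory = monad_on_sets \<T>
  for \<T> :: "('u::set_universe, 'v::comm_quantale) top_theory" +
  assumes vcode_bij: "bij_betw (vcode \<T>) UNIV (elts (Vob \<T>))"
    and Tmap_weak_pullback: "weak_pullback P A B C p q f g \<Longrightarrow>
      weak_pullback (Tob \<T> P) (Tob \<T> A) (Tob \<T> B) (Tob \<T> C)
        (Tmap \<T> P A p) (Tmap \<T> P B q) (Tmap \<T> A C f) (Tmap \<T> B C g)"
    and mmult_weak_pullback: "f \<in> elts X \<rightarrow> elts Y \<Longrightarrow>
      weak_pullback (Tob \<T> (Tob \<T> X)) (Tob \<T> X) (Tob \<T> (Tob \<T> Y)) (Tob \<T> Y)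
        (mmult \<T> X) (Tmap \<T> (Tob \<T> X) (Tob \<T> Y) (Tmap \<T> X Y f)) (Tmap \<T> X Y f) (mmult \<T> Y)"
    and xi_munit: "xi \<T> (munit \<T> (Vob \<T>) (vcode \<T> v)) = v"
    and xi_mmult: "t \<in> elts (Tob \<T> (Tob \<T> (Vob \<T>))) \<Longrightarrow>
      xi \<T> (mmult \<T> (Vob \<T>) t) = xiT \<T> (Tob \<T> (Vob \<T>)) (xi \<T>) t"
    and xi_times: "w \<in> elts (Tob \<T> (uprod (Vob \<T>) (Vob \<T>))) \<Longrightarrow>
      xiT \<T> (uprod (Vob \<T>) (Vob \<T>)) (\<lambda>z. vdecode \<T> (ufst z) * vdecode \<T> (usnd z)) w =
      xi \<T> (Tmap \<T> (uprod (Vob \<T>) (Vob \<T>)) (Vob \<T>) ufst w) *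
      xi \<T> (Tmap \<T> (uprod (Vob \<T>) (Vob \<T>)) (Vob \<T>) usnd w)"
    and xi_one: "t \<in> elts (Tob \<T> uone) \<Longrightarrow> xiT \<T> uone (\<lambda>_. 1) t = 1"
    and xi_shriek: "\<lbrakk>f \<in> elts X \<rightarrow> elts Y; t \<in> elts (Tob \<T> Y)\<rbrakk> \<Longrightarrow>
      xiT \<T> Y (shriek X f \<phi>) t = shriek (Tob \<T> X) (Tmap \<T> X Y f) (xiT \<T> X \<phi>) t"


section \<open>Relations with values in the quantale\<close>

text \<open>A relation from \<open>X\<close> to \<open>Y\<close> is a HOL function of two arguments whose values outside of
  \<open>elts X\<close> and \<open>elts Y\<close> are irrelevant.\<close>

definition rel_le ::
  "'u::set_universe \<Rightarrow> 'u \<Rightarrow> ('u \<Rightarrow> 'u \<Rightarrow> 'v::comm_quantale) \<Rightarrow> ('u \<Rightarrow> 'u \<Rightarrow> 'v) \<Rightarrow> bool" where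
  "rel_le X Y r s \<longleftrightarrow> (\<forall>x\<in>elts X. \<forall>y\<in>elts Y. r x y \<le> s x y)"

definition rel_eq :: "'u::set_universe \<Rightarrow> 'u \<Rightarrow> ('u \<Rightarrow> 'u \<Rightarrow> 'v) \<Rightarrow> ('u \<Rightarrow> 'u \<Rightarrow> 'v) \<Rightarrow> bool" where
  "rel_eq X Y r s \<longleftrightarrow> (\<forall>x\<in>elts X. \<forall>y\<in>elts Y. r x y = s x y)"

text \<open>\<open>rel_comp Y s r\<close> is the composite \<open>s \<cdot> r\<close> over the middle object \<open>Y\<close>.\<close>

definition rel_comp ::
  "'u::set_universe \<Rightarrow> ('u \<Rightarrow> 'u \<Rightarrow> 'v::comm_quantale) \<Rightarrow> ('u \<Rightarrow> 'u \<Rightarrow> 'v) \<Rightarrow> 'u \<Rightarrow> 'u \<Rightarrow> 'v" where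
  "rel_comp Y s r x z = (SUP y\<in>elts Y. r x y * s y z)"

definition rel_conv :: "('u \<Rightarrow> 'u \<Rightarrow> 'v) \<Rightarrow> 'u \<Rightarrow> 'u \<Rightarrow> 'v" where
  "rel_conv r y x = r x y"

definition map_rel :: "('u \<Rightarrow> 'u) \<Rightarrow> 'u \<Rightarrow> 'u \<Rightarrow> 'v::comm_quantale" where
  "map_rel f x y = (if f x = y then 1 else bot)"

definition Txi ::
  "('u::set_universe, 'v::comm_quantale) top_theory \<Rightarrow> 'u \<Rightarrow> 'u \<Rightarrow> ('u \<Rightarrow> 'u \<Rightarrow> 'v) \<Rightarrow> 'u \<Rightarrow> 'u \<Rightarrow> 'v"
where
  "Txi \<T> X Y r \<xx> \<yy> =
     (SUP w \<in> {w \<in> elts (Tob \<T> (uprod X Y)).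
                 Tmap \<T> (uprod X Y) X ufst w = \<xx> \<and> Tmap \<T> (uprod X Y) Y usnd w = \<yy>}.
        xiT \<T> (uprod X Y) (\<lambda>z. r (ufst z) (usnd z)) w)"


section \<open>Graphs, categories and the exponential\<close>

definition T_graph ::
  "('u::set_universe, 'v::comm_quantale) top_theory \<Rightarrow> 'u \<Rightarrow> ('u \<Rightarrow> 'u \<Rightarrow> 'v) \<Rightarrow> bool" where
  "T_graph \<T> X a \<longleftrightarrow> rel_le (Tob \<T> X) X (rel_conv (map_rel (munit \<T> X))) a"

definition T_category ::
  "('u::set_universe, 'v::comm_quantale) top_theory \<Rightarrow> 'u \<Rightarrow> ('u \<Rightarrow> 'u \<Rightarrow> 'v) \<Rightarrow> bool" where
  "T_category \<T> X a \<longleftrightarrow> T_graph \<T> X a \<and>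
     rel_le (Tob \<T> X) X
       (rel_comp (Tob \<T> X) a
         (rel_comp (Tob \<T> (Tob \<T> X)) (Txi \<T> (Tob \<T> X) X a) (rel_conv (map_rel (mmult \<T> X)))))
       a"

definition T_functor ::
  "('u::set_universe, 'v::comm_quantale) top_theory \<Rightarrow> 'u \<Rightarrow> ('u \<Rightarrow> 'u \<Rightarrow> 'v) \<Rightarrow>
    'u \<Rightarrow> ('u \<Rightarrow> 'u \<Rightarrow> 'v) \<Rightarrow> ('u \<Rightarrow> 'u) \<Rightarrow> bool" where
  "T_functor \<T> X a Y b f \<longleftrightarrow> f \<in> elts X \<rightarrow> elts Y \<and>
     (\<forall>\<xx>\<in>elts (Tob \<T> X). \<forall>x\<in>elts X. a \<xx> x \<le> b (Tmap \<T> X Y f \<xx>) (f x))"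

definition dualisable ::
  "('u::set_universe, 'v::comm_quantale) top_theory \<Rightarrow> 'u \<Rightarrow> ('u \<Rightarrow> 'u \<Rightarrow> 'v) \<Rightarrow> bool" where
  "dualisable \<T> X a \<longleftrightarrow> T_graph \<T> X a \<and>
     (let a0 = rel_comp (Tob \<T> X) a (map_rel (munit \<T> X)) in
        rel_le X X (rel_comp X a0 a0) a0 \<and>
        (\<exists>\<alpha> \<in> elts (Tob \<T> X) \<rightarrow> elts X. rel_eq (Tob \<T> X) X a (rel_comp X a0 (map_rel \<alpha>))))"

definition V_struct :: "('u, 'v::comm_quantale) top_theory \<Rightarrow> 'u \<Rightarrow> 'u \<Rightarrow> 'v" where
  "V_struct \<T> \<vv> v = qhom (xi \<T> \<vv>) (vdecode \<T> v)"

definition exp_ob ::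
  "('u::set_universe, 'v::comm_quantale) top_theory \<Rightarrow> 'u \<Rightarrow> ('u \<Rightarrow> 'u \<Rightarrow> 'v) \<Rightarrow> 'u" where
  "exp_ob \<T> X a = mk (ugraph X ` {f. T_functor \<T> X a (Vob \<T>) (V_struct \<T>) f})"

lemma elts_exp_ob:
  "elts (exp_ob \<T> X a) = ugraph X ` {f. T_functor \<T> X a (Vob \<T>) (V_struct \<T>) f}"
  unfolding exp_ob_def by (rule elts_mk_ugraphs) (auto simp: T_functor_def)

definition ev :: "'u::set_universe \<Rightarrow> 'u" where
  "ev z = uapp (ufst z) (usnd z)"

definition exp_struct ::
  "('u::set_universe, 'v::comm_quantale) top_theory \<Rightarrow> 'u \<Rightarrow> ('u \<Rightarrow> 'u \<Rightarrow> 'v) \<Rightarrow> 'u \<Rightarrow> 'u \<Rightarrow> 'v"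
where
  "exp_struct \<T> X a \<pp> h =
     (let E = exp_ob \<T> X a; P = uprod E X in
      INF (\<qq>, x) \<in> {\<qq> \<in> elts (Tob \<T> P). Tmap \<T> P E ufst \<qq> = \<pp>} \<times> elts X.
        qhom (a (Tmap \<T> P X usnd \<qq>) x)
             (qhom (xi \<T> (Tmap \<T> P (Vob \<T>) ev \<qq>)) (vdecode \<T> (uapp h x))))"

end

theory Submission
  imports Defs
begin

text \<open>
  Write \<open>E\<close> for the object of \<open>\<T>\<close>-functors \<open>X \<rightarrow> V\<close> and \<open>d\<close> for its structure. By the adjunction
  between \<open>\<otimes>\<close> and \<open>hom\<close>, and since a \<open>hom\<close> out of a supremum is an infimum,
  \<open>d(\<pp>, h) = \<And>\<^sub>x hom(\<lambda>(\<pp>)(x), h(x))\<close>, where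
  \<open>\<lambda>(\<pp>)(x)\<close> is the supremum of \<open>a(T\<pi>\<^sub>2(\<qq>), x) \<otimes> \<xi>(T ev(\<qq>))\<close> over all \<open>\<qq>\<close> with \<open>T\<pi>\<^sub>1(\<qq>) = \<pp>\<close>
  (\<open>least_limit\<close> below). For topological spaces, \<open>\<lambda>(\<pp>)\<close> is the least point, in the
  pointwise order, to which \<open>\<pp>\<close> converges.
  Everything rests on two properties of \<open>\<lambda>\<close>.

  Firstly, \<open>\<lambda>(e(h)) = h\<close> (\<open>least_limit_munit\<close>). The functor \<open>T\<close> preserves the weak pullback of
  \<open>h : 1 \<rightarrow> E\<close> along \<open>\<pi>\<^sub>1\<close>, so each \<open>\<qq>\<close> over \<open>e(h)\<close> is the image under \<open>T\<langle>h, id\<rangle>\<close> of some \<open>\<xx> \<in> TX\<close>,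
  and the inequality \<open>\<le>\<close> becomes the functoriality of \<open>h\<close>; for \<open>\<ge>\<close> one takes \<open>\<qq> = e(h, x)\<close>. It follows
  that \<open>d\<^sub>0(h, h') = \<And>\<^sub>x hom(h(x), h'(x))\<close>, which is reflexive and transitive.

  Secondly, \<open>\<lambda>(\<pp>)\<close> is itself a \<open>\<T>\<close>-functor (\<open>least_limit_functor\<close>), so that the formula for \<open>d\<close> reads
  \<open>d = d\<^sub>0 \<cdot> \<lambda>\<close>. Compatibility of \<open>\<xi>\<close> with suprema along maps expresses \<open>\<xi>(T(\<lambda>(\<pp>))(\<xx>))\<close> as a supremum
  over elements of \<open>T(Q \<times> X)\<close>, \<open>Q\<close> being the set of all \<open>\<qq>\<close> over \<open>\<pp>\<close>. Such an element yields
  some \<open>W \<in> TT(E \<times> X)\<close>, and transitivity of \<open>a\<close> bounds its contribution by the term of \<open>\<lambda>(\<pp>)\<close> at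
  \<open>m(W)\<close>. That \<open>m(W)\<close> lies over \<open>\<pp>\<close> is where \<open>T1 = 1\<close> enters: it makes \<open>T\<close> of the
  map constant at \<open>\<pp>\<close> constant at \<open>e(\<pp>)\<close>, and \<open>m(e(\<pp>)) = \<pp>\<close>.
\<close>

section \<open>Commutative quantales\<close>

lemma times_bot [simp]: "(x::'v::comm_quantale) * bot = bot"
  using times_Sup[of x "{}"] by simp

lemma bot_times [simp]: "bot * (x::'v::comm_quantale) = bot"
  by (subst mult.commute) simp

lemma times_mono:
  fixes x :: "'v::comm_quantale"
  assumes "x \<le> x'" "y \<le> y'"
  shows "x * y \<le> x' * y'"
proof -
  have mono: "z * u \<le> z * w" if "u \<le> w" for z u w :: 'v
  proof -
    have "z * w = sup (z * u) (z * w)"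
      using times_Sup[of z "{u, w}"] sup_absorb2[OF that] by simp
    then show ?thesis by (metis sup_ge1)
  qed
  have "x * y \<le> x * y'" using mono[OF assms(2)] .
  also have "\<dots> \<le> x' * y'" using mono[OF assms(1), of y'] by (simp add: mult.commute)
  finally show ?thesis .
qed

lemma times_SUP: "(x::'v::comm_quantale) * (SUP i\<in>I. f i) = (SUP i\<in>I. x * f i)"
  by (simp add: times_Sup image_image)

lemma le_qhom_SUP:
  "(y::'v::comm_quantale) \<le> qhom (SUP i\<in>I. f i) z \<longleftrightarrow> (\<forall>i\<in>I. y \<le> qhom (f i) z)"
  by (simp add: qhom_adjoint[symmetric] times_SUP SUP_le_iff)

lemma qhom_qhom: "qhom (x::'v::comm_quantale) (qhom y z) = qhom (x * y) z"
proof (rule antisym)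
  have "qhom x (qhom y z) * x * y \<le> z"
    by (simp add: qhom_adjoint)
  then show "qhom x (qhom y z) \<le> qhom (x * y) z"
    by (simp add: qhom_adjoint[symmetric] mult.assoc)
  have "qhom (x * y) z * x * y \<le> z"
    by (simp add: qhom_adjoint mult.assoc)
  then show "qhom (x * y) z \<le> qhom x (qhom y z)"
    by (simp add: qhom_adjoint)
qed

lemma one_le_qhom: "1 \<le> qhom (x::'v::comm_quantale) x"
  by (simp add: qhom_adjoint[symmetric])

lemma qhom_trans: "qhom x y * qhom y z \<le> qhom (x::'v::comm_quantale) z"
proof -
  have "qhom x y * x \<le> y"
    by (simp add: qhom_adjoint)
  then have "qhom y z * (qhom x y * x) \<le> qhom y z * y"
    by (intro times_mono order_refl)
  also have "\<dots> \<le> z"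
    by (simp add: qhom_adjoint)
  finally show ?thesis
    by (simp add: qhom_adjoint[symmetric] mult_ac)
qed

lemma rel_comp_map_rel:
  assumes "f x \<in> elts Y"
  shows "rel_comp Y s (map_rel f) x z = (s (f x) z :: 'v::comm_quantale)"
proof (rule antisym)
  show "rel_comp Y s (map_rel f) x z \<le> s (f x) z"
    unfolding rel_comp_def map_rel_def by (rule SUP_least) auto
  show "s (f x) z \<le> rel_comp Y s (map_rel f) x z"
    unfolding rel_comp_def using assms by (intro SUP_upper2[of "f x"]) (simp_all add: map_rel_def)
qed

section \<open>The extension of \<open>\<xi>\<close> to maps into the quantale\<close>

lemma pair_in_uprod [simp]: "pair x y \<in> elts (uprod X Y) \<longleftrightarrow> x \<in> elts X \<and> y \<in> elts Y"
  by (auto simp: elts_uprod)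

lemma ufst_in [simp]: "ufst \<in> elts (uprod X Y) \<rightarrow> elts X"
  by (auto simp: elts_uprod)

lemma usnd_in [simp]: "usnd \<in> elts (uprod X Y) \<rightarrow> elts Y"
  by (auto simp: elts_uprod)

context monad_on_sets
begin

lemma Tmap_elts: "\<lbrakk>f \<in> elts X \<rightarrow> elts Y; t \<in> elts (Tob M X)\<rbrakk> \<Longrightarrow> Tmap M X Y f t \<in> elts (Tob M Y)"
  using Tmap_in by blast

lemma munit_elts: "x \<in> elts X \<Longrightarrow> munit M X x \<in> elts (Tob M X)"
  using munit_in by blast

lemma mmult_elts: "t \<in> elts (Tob M (Tob M X)) \<Longrightarrow> mmult M X t \<in> elts (Tob M X)"
  using mmult_in by blast

lemma Tmap_Tmap:
  assumes "f \<in> elts X \<rightarrow> elts Y" "g \<in> elts Y \<rightarrow> elts Z" "t \<in> elts (Tob M X)"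
    and "\<And>x. x \<in> elts X \<Longrightarrow> h x = g (f x)"
  shows "Tmap M Y Z g (Tmap M X Y f t) = Tmap M X Z h t"
proof -
  have "Tmap M X Z h t = Tmap M X Z (g \<circ> f) t"
    using assms by (intro Tmap_cong) auto
  then show ?thesis
    using Tmap_comp[OF assms(1-3)] by simp
qed

text \<open>A constant map factors through \<open>1\<close>, and \<open>T1\<close> has no element besides the one given by the
  unit.\<close>

lemma Tmap_const:
  assumes "is_singleton (elts (Tob M uone))" "y \<in> elts Y" "t \<in> elts (Tob M X)"
    and "\<And>x. x \<in> elts X \<Longrightarrow> c x = y"
  shows "Tmap M X Y c t = munit M Y y"
proof -
  let ?o = "mk {} :: 'u"
  have o: "?o \<in> elts uone" by (simp add: elts_uone)
  then have "Tmap M X uone (\<lambda>_. ?o) t \<in> elts (Tob M uone)"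
    using assms by (intro Tmap_elts) auto
  then have "Tmap M X uone (\<lambda>_. ?o) t = munit M uone ?o"
    using assms(1) munit_elts[OF o] by (auto elim!: is_singletonE)
  then have "Tmap M uone Y (\<lambda>_. y) (munit M uone ?o) = Tmap M uone Y (\<lambda>_. y) (Tmap M X uone (\<lambda>_. ?o) t)"
    by simp
  also have "\<dots> = Tmap M X Y c t"
    using assms o by (intro Tmap_Tmap) auto
  finally show ?thesis
    using munit_natural[of "\<lambda>_. y" uone Y ?o] assms(2) o by simp
qed

end

context topological_theory
begin

lemma vcode_in [simp]: "vcode \<T> v \<in> elts (Vob \<T>)"
  using vcode_bij by (auto simp: bij_betw_def)

lemma vdecode_vcode [simp]: "vdecode \<T> (vcode \<T> v) = v"
  using vcode_bij by (simp add: bij_betw_def vdecode_def)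

lemma vcode_vdecode: "u \<in> elts (Vob \<T>) \<Longrightarrow> vcode \<T> (vdecode \<T> u) = u"
  using vcode_bij by (auto simp: bij_betw_def vdecode_def f_inv_into_f)

lemma xiT_cong:
  assumes "\<And>x. x \<in> elts X \<Longrightarrow> \<phi> x = \<psi> x" "t \<in> elts (Tob \<T> X)"
  shows "xiT \<T> X \<phi> t = xiT \<T> X \<psi> t"
  unfolding xiT_def using assms by (subst Tmap_cong[of _ X _ "vcode \<T> \<circ> \<psi>"]) auto

lemma xi_Tmap:
  assumes "f \<in> elts X \<rightarrow> elts (Vob \<T>)" "t \<in> elts (Tob \<T> X)"
  shows "xi \<T> (Tmap \<T> X (Vob \<T>) f t) = xiT \<T> X (vdecode \<T> \<circ> f) t"
  unfolding xiT_def using assms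
  by (subst Tmap_cong[of f X _ "vcode \<T> \<circ> (vdecode \<T> \<circ> f)"])
     (auto simp: vcode_vdecode Pi_iff)

lemma xiT_Tmap:
  assumes "f \<in> elts X \<rightarrow> elts Y" "t \<in> elts (Tob \<T> X)"
    and "\<And>x. x \<in> elts X \<Longrightarrow> \<phi> x = \<psi> (f x)"
  shows "xiT \<T> Y \<psi> (Tmap \<T> X Y f t) = xiT \<T> X \<phi> t"
  unfolding xiT_def using assms by (subst Tmap_Tmap[of _ _ _ _ _ _ "vcode \<T> \<circ> \<phi>"]) auto

lemma xiT_munit:
  assumes "x \<in> elts X"
  shows "xiT \<T> X \<phi> (munit \<T> X x) = \<phi> x"
  unfolding xiT_def using assms by (subst munit_natural) (auto simp: xi_munit)

text \<open>The hypothesis on \<open>\<xi>\<close> and \<open>\<otimes>\<close> concerns \<open>T(V \<times> V)\<close> only; it is pulled back along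
  \<open>\<langle>\<phi>, \<psi>\<rangle> : X \<rightarrow> V \<times> V\<close>.\<close>

lemma xiT_times:
  assumes t: "t \<in> elts (Tob \<T> X)"
  shows "xiT \<T> X (\<lambda>x. \<phi> x * \<psi> x) t = xiT \<T> X \<phi> t * xiT \<T> X \<psi> t"
proof -
  let ?V = "Vob \<T>" and ?f = "\<lambda>x. pair (vcode \<T> (\<phi> x)) (vcode \<T> (\<psi> x))"
  let ?w = "Tmap \<T> X (uprod ?V ?V) ?f t"
  have f: "?f \<in> elts X \<rightarrow> elts (uprod ?V ?V)" by auto
  have w: "?w \<in> elts (Tob \<T> (uprod ?V ?V))" using f t by (rule Tmap_elts)
  have "xiT \<T> X (\<lambda>x. \<phi> x * \<psi> x) t =
      xiT \<T> (uprod ?V ?V) (\<lambda>z. vdecode \<T> (ufst z) * vdecode \<T> (usnd z)) ?w"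
    by (rule xiT_Tmap[symmetric, OF f t]) simp
  also have "\<dots> = xi \<T> (Tmap \<T> (uprod ?V ?V) ?V ufst ?w) * xi \<T> (Tmap \<T> (uprod ?V ?V) ?V usnd ?w)"
    by (rule xi_times[OF w])
  also have "\<dots> = xiT \<T> X \<phi> t * xiT \<T> X \<psi> t"
  proof -
    have "Tmap \<T> (uprod ?V ?V) ?V ufst ?w = Tmap \<T> X ?V (vcode \<T> \<circ> \<phi>) t"
      "Tmap \<T> (uprod ?V ?V) ?V usnd ?w = Tmap \<T> X ?V (vcode \<T> \<circ> \<psi>) t"
      by (rule Tmap_Tmap[OF f _ t]; simp)+
    then show ?thesis by (simp only: xiT_def)
  qed
  finally show ?thesis .
qed

lemma xiT_mmult:
  assumes t: "t \<in> elts (Tob \<T> (Tob \<T> X))"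
  shows "xiT \<T> X \<phi> (mmult \<T> X t) = xiT \<T> (Tob \<T> X) (xiT \<T> X \<phi>) t"
proof -
  let ?V = "Vob \<T>"
  have f: "vcode \<T> \<circ> \<phi> \<in> elts X \<rightarrow> elts ?V" by auto
  note Tf = Tmap_in[OF f]
  have "xiT \<T> X \<phi> (mmult \<T> X t) =
      xi \<T> (mmult \<T> ?V (Tmap \<T> (Tob \<T> X) (Tob \<T> ?V) (Tmap \<T> X ?V (vcode \<T> \<circ> \<phi>)) t))"
    unfolding xiT_def by (simp add: mmult_natural[OF f t])
  also have "\<dots> = xiT \<T> (Tob \<T> ?V) (xi \<T>)
      (Tmap \<T> (Tob \<T> X) (Tob \<T> ?V) (Tmap \<T> X ?V (vcode \<T> \<circ> \<phi>)) t)"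
    by (rule xi_mmult[OF Tmap_elts[OF Tf t]])
  also have "\<dots> = xiT \<T> (Tob \<T> X) (xiT \<T> X \<phi>) t"
    by (rule xiT_Tmap[OF Tf t]) (simp add: xiT_def)
  finally show ?thesis .
qed

lemma T_functor_Vob_iff:
  assumes "f \<in> elts X \<rightarrow> elts (Vob \<T>)"
  shows "T_functor \<T> X a (Vob \<T>) (V_struct \<T>) f \<longleftrightarrow>
    (\<forall>\<xx>\<in>elts (Tob \<T> X). \<forall>x\<in>elts X. a \<xx> x * xiT \<T> X (vdecode \<T> \<circ> f) \<xx> \<le> vdecode \<T> (f x))"
  using assms by (auto simp: T_functor_def V_struct_def qhom_adjoint xi_Tmap)

lemma T_category_refl:
  assumes "T_category \<T> X a" "x \<in> elts X"
  shows "1 \<le> a (munit \<T> X x) x"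
proof -
  have "rel_conv (map_rel (munit \<T> X)) (munit \<T> X x) x \<le> a (munit \<T> X x) x"
    using assms munit_elts[OF assms(2)] by (auto simp: T_category_def T_graph_def rel_le_def)
  then show ?thesis by (simp add: rel_conv_def map_rel_def)
qed

lemma T_category_trans:
  assumes "T_category \<T> X a" and W: "W \<in> elts (Tob \<T> (Tob \<T> X))"
    and t: "t \<in> elts (Tob \<T> X)" and x: "x \<in> elts X"
  shows "Txi \<T> (Tob \<T> X) X a W t * a t x \<le> a (mmult \<T> X W) x"
proof -
  let ?b = "rel_comp (Tob \<T> (Tob \<T> X)) (Txi \<T> (Tob \<T> X) X a) (rel_conv (map_rel (mmult \<T> X)))"
  have "Txi \<T> (Tob \<T> X) X a W t \<le> ?b (mmult \<T> X W) t"
    unfolding rel_comp_def using W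
    by (intro SUP_upper2[of W]) (simp_all add: rel_conv_def map_rel_def)
  then have "Txi \<T> (Tob \<T> X) X a W t * a t x \<le> ?b (mmult \<T> X W) t * a t x"
    by (intro times_mono order_refl)
  also have "\<dots> \<le> rel_comp (Tob \<T> X) a ?b (mmult \<T> X W) x"
    unfolding rel_comp_def[of "Tob \<T> X"] using t by (rule SUP_upper)
  also have "\<dots> \<le> a (mmult \<T> X W) x"
    using assms(1) mmult_elts[OF W] x unfolding T_category_def rel_le_def by blast
  finally show ?thesis .
qed

section \<open>The least limit of an element of \<open>T(V\<^sup>X)\<close>\<close>

lemma ev_in: "ev \<in> elts (uprod (exp_ob \<T> X a) X) \<rightarrow> elts (Vob \<T>)"
  by (auto simp: elts_uprod elts_exp_ob ev_def uapp_ugraph T_functor_def)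

lemma exp_ob_functor:
  assumes "h \<in> elts (exp_ob \<T> X a)" "\<xx> \<in> elts (Tob \<T> X)" "x \<in> elts X"
  shows "a \<xx> x * xiT \<T> X (\<lambda>x. vdecode \<T> (uapp h x)) \<xx> \<le> vdecode \<T> (uapp h x)"
proof -
  obtain f where f: "T_functor \<T> X a (Vob \<T>) (V_struct \<T>) f" and h: "h = ugraph X f"
    using assms(1) by (auto simp: elts_exp_ob)
  have "xiT \<T> X (\<lambda>x. vdecode \<T> (uapp h x)) \<xx> = xiT \<T> X (vdecode \<T> \<circ> f) \<xx>"
    using assms(2) by (intro xiT_cong) (simp_all add: h uapp_ugraph)
  moreover have "f \<in> elts X \<rightarrow> elts (Vob \<T>)"
    using f by (simp add: T_functor_def)
  ultimately show ?thesis
    using f assms by (simp add: T_functor_Vob_iff h uapp_ugraph)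
qed

definition least_limit :: "'u \<Rightarrow> ('u \<Rightarrow> 'u \<Rightarrow> 'v) \<Rightarrow> 'u \<Rightarrow> 'u \<Rightarrow> 'v" where
  "least_limit X a \<pp> x = (let E = exp_ob \<T> X a; P = uprod E X in
     SUP \<qq>\<in>{\<qq> \<in> elts (Tob \<T> P). Tmap \<T> P E ufst \<qq> = \<pp>}.
       a (Tmap \<T> P X usnd \<qq>) x * xiT \<T> P (vdecode \<T> \<circ> ev) \<qq>)"

lemma exp_struct_least_limit:
  "exp_struct \<T> X a \<pp> h = (INF x\<in>elts X. qhom (least_limit X a \<pp> x) (vdecode \<T> (uapp h x)))"
proof -
  let ?E = "exp_ob \<T> X a" and ?P = "uprod (exp_ob \<T> X a) X"
  have "y \<le> exp_struct \<T> X a \<pp> h \<longleftrightarrow>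
      y \<le> (INF x\<in>elts X. qhom (least_limit X a \<pp> x) (vdecode \<T> (uapp h x)))" for y
    by (auto simp: exp_struct_def least_limit_def Let_def le_INF_iff le_qhom_SUP qhom_qhom
        xi_Tmap[OF ev_in])
  then show ?thesis by (metis order_refl antisym)
qed

text \<open>The set \<open>X\<close>, with \<open>x \<mapsto> (h, x)\<close>, is a pullback of \<open>h : 1 \<rightarrow> E\<close> along \<open>\<pi>\<^sub>1 : E \<times> X \<rightarrow> E\<close>, and \<open>T\<close>
  preserves it weakly.\<close>

lemma Tmap_ufst_eq_munit:
  assumes h: "h \<in> elts E" and q: "\<qq> \<in> elts (Tob \<T> (uprod E X))"
    and eq: "Tmap \<T> (uprod E X) E ufst \<qq> = munit \<T> E h"
  obtains \<xx> where "\<xx> \<in> elts (Tob \<T> X)" "\<qq> = Tmap \<T> X (uprod E X) (pair h) \<xx>"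
proof -
  let ?o = "mk {} :: 'u"
  have o: "?o \<in> elts uone" by (simp add: elts_uone)
  have "weak_pullback X uone (uprod E X) E (\<lambda>_. ?o) (pair h) (\<lambda>_. h) ufst"
    unfolding weak_pullback_def
  proof (intro conjI allI ballI impI)
    fix Q :: 'u and u v :: "'u \<Rightarrow> 'u"
    assume u: "u \<in> elts Q \<rightarrow> elts uone" and v: "v \<in> elts Q \<rightarrow> elts (uprod E X)"
      and uv: "\<forall>z\<in>elts Q. h = ufst (v z)"
    have "usnd \<circ> v \<in> elts Q \<rightarrow> elts X"
      using funcset_mem[OF usnd_in funcset_mem[OF v]] by auto
    moreover have "?o = u z \<and> pair h ((usnd \<circ> v) z) = v z" if z: "z \<in> elts Q" for z
    proof -
      obtain e y where "v z = pair e y"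
        using v z by (force simp: elts_uprod)
      moreover have "u z \<in> elts uone"
        using u z by (rule funcset_mem)
      ultimately show ?thesis using uv z by (simp add: elts_uone)
    qed
    ultimately show "\<exists>w\<in>elts Q \<rightarrow> elts X. \<forall>z\<in>elts Q. ?o = u z \<and> pair h (w z) = v z" by blast
  qed (use h o in auto)
  from Tmap_weak_pullback[OF this]
  have wp: "\<And>(Q::'u) u v. \<lbrakk>u \<in> elts Q \<rightarrow> elts (Tob \<T> uone); v \<in> elts Q \<rightarrow> elts (Tob \<T> (uprod E X));
      \<forall>z\<in>elts Q. Tmap \<T> uone E (\<lambda>_. h) (u z) = Tmap \<T> (uprod E X) E ufst (v z)\<rbrakk> \<Longrightarrow>
      \<exists>w\<in>elts Q \<rightarrow> elts (Tob \<T> X). \<forall>z\<in>elts Q. Tmap \<T> X uone (\<lambda>_. ?o) (w z) = u z \<and>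
        Tmap \<T> X (uprod E X) (pair h) (w z) = v z"
    unfolding weak_pullback_def by blast
  have "Tmap \<T> uone E (\<lambda>_. h) (munit \<T> uone ?o) = munit \<T> E h"
    using munit_natural[of "\<lambda>_. h" uone E ?o] h o by simp
  then obtain w :: "'u \<Rightarrow> 'u" where w: "w \<in> elts uone \<rightarrow> elts (Tob \<T> X)"
    and w': "\<forall>z\<in>elts uone. Tmap \<T> X uone (\<lambda>_. ?o) (w z) = munit \<T> uone ?o \<and>
        Tmap \<T> X (uprod E X) (pair h) (w z) = \<qq>"
    using wp[of "\<lambda>_. munit \<T> uone ?o" uone "\<lambda>_. \<qq>"] munit_elts[OF o] q eq by auto
  show ?thesis
    using that[of "w ?o"] w w' o by auto
qed

lemma least_limit_munit:
  assumes cat: "T_category \<T> X a" and h: "h \<in> elts (exp_ob \<T> X a)" and x: "x \<in> elts X"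
  shows "least_limit X a (munit \<T> (exp_ob \<T> X a) h) x = vdecode \<T> (uapp h x)"
proof -
  let ?E = "exp_ob \<T> X a"
  let ?P = "uprod ?E X"
  let ?\<phi> = "\<lambda>x. vdecode \<T> (uapp h x)"
  have hP: "pair h \<in> elts X \<rightarrow> elts ?P"
    using h by auto
  show ?thesis
  proof (rule antisym)
    show "least_limit X a (munit \<T> ?E h) x \<le> ?\<phi> x"
      unfolding least_limit_def Let_def
    proof (rule SUP_least, clarsimp)
      fix \<qq> assume "\<qq> \<in> elts (Tob \<T> ?P)" "Tmap \<T> ?P ?E ufst \<qq> = munit \<T> ?E h"
      then obtain \<xx> where t: "\<xx> \<in> elts (Tob \<T> X)" and q: "\<qq> = Tmap \<T> X ?P (pair h) \<xx>"
        using Tmap_ufst_eq_munit[OF h] by blast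
      have "Tmap \<T> ?P X usnd \<qq> = Tmap \<T> X X id \<xx>"
        unfolding q by (rule Tmap_Tmap[OF hP _ t]) auto
      moreover have "xiT \<T> ?P (vdecode \<T> \<circ> ev) \<qq> = xiT \<T> X ?\<phi> \<xx>"
        unfolding q by (rule xiT_Tmap[OF hP t]) (simp add: ev_def)
      ultimately show "a (Tmap \<T> ?P X usnd \<qq>) x * xiT \<T> ?P (vdecode \<T> \<circ> ev) \<qq> \<le> ?\<phi> x"
        using exp_ob_functor[OF h t x] by (simp add: Tmap_id[OF t])
    qed
    let ?q = "munit \<T> ?P (pair h x)"
    have hx: "pair h x \<in> elts ?P" using h x by simp
    have "Tmap \<T> ?P ?E ufst ?q = munit \<T> ?E h" "Tmap \<T> ?P X usnd ?q = munit \<T> X x"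
      by (simp_all add: munit_natural[OF _ hx])
    moreover have "xiT \<T> ?P (vdecode \<T> \<circ> ev) ?q = ?\<phi> x"
      using xiT_munit[OF hx] by (simp add: ev_def)
    moreover have "?\<phi> x \<le> a (munit \<T> X x) x * ?\<phi> x"
      using times_mono[OF T_category_refl[OF cat x] order_refl, of "?\<phi> x"] by simp
    ultimately show "?\<phi> x \<le> least_limit X a (munit \<T> ?E h) x"
      unfolding least_limit_def Let_def using munit_elts[OF hx]
      by (intro SUP_upper2[of ?q]) auto
  qed
qed

text \<open>Functoriality of \<open>\<lambda>(\<pp>)\<close>: an element \<open>w\<close> of \<open>T(Q \<times> X)\<close> over \<open>\<xx>\<close> contributes to
  \<open>a(\<xx>, x) \<otimes> \<xi>(T(\<lambda>(\<pp>))(\<xx>))\<close> at most \<open>a(\<xx>, x) \<otimes> T\<^sub>\<xi>a(TT\<pi>\<^sub>2(W), \<xx>) \<otimes> \<xi>(T ev(m(W)))\<close>, where \<open>W\<close> is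
  the image of \<open>w\<close> in \<open>TT(E \<times> X)\<close>.\<close>

lemma least_limit_functor:
  assumes one: "is_singleton (elts (Tob \<T> uone))" and cat: "T_category \<T> X a"
    and p: "\<pp> \<in> elts (Tob \<T> (exp_ob \<T> X a))"
    and t: "\<xx> \<in> elts (Tob \<T> X)" and x: "x \<in> elts X"
  shows "a \<xx> x * xiT \<T> X (least_limit X a \<pp>) \<xx> \<le> least_limit X a \<pp> x"
proof -
  define E where "E = exp_ob \<T> X a"
  define P where "P = uprod E X"
  let ?TX = "Tob \<T> X" and ?TP = "Tob \<T> P"
  let ?ev = "xiT \<T> P (vdecode \<T> \<circ> ev)"
  let ?\<pi>1 = "Tmap \<T> P E ufst" and ?\<pi>2 = "Tmap \<T> P X usnd"
  have ll: "least_limit X a \<pp> y =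
      (SUP \<qq>\<in>{\<qq> \<in> elts ?TP. ?\<pi>1 \<qq> = \<pp>}. a (?\<pi>2 \<qq>) y * ?ev \<qq>)" for y
    by (simp add: least_limit_def Let_def E_def P_def)
  have fst_in: "ufst \<in> elts P \<rightarrow> elts E" and snd_in: "usnd \<in> elts P \<rightarrow> elts X"
    unfolding P_def by simp_all
  note \<pi>1 = Tmap_in[OF fst_in] and \<pi>2 = Tmap_in[OF snd_in]
  obtain Q :: 'u where Q: "elts Q = {\<qq> \<in> elts ?TP. ?\<pi>1 \<qq> = \<pp>}"
    using ex_elts_subset[of "{\<qq> \<in> elts ?TP. ?\<pi>1 \<qq> = \<pp>}" ?TP] by blast
  define R where "R = uprod Q X"
  define \<phi> where "\<phi> z = a (?\<pi>2 (ufst z)) (usnd z) * ?ev (ufst z)" for z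
  have R_fst: "ufst \<in> elts R \<rightarrow> elts ?TP" and R_snd: "usnd \<in> elts R \<rightarrow> elts X"
    using Q by (auto simp: R_def elts_uprod)
  have shriek: "least_limit X a \<pp> y = shriek R usnd \<phi> y" if y: "y \<in> elts X" for y
  proof -
    have "{z \<in> elts R. usnd z = y} = (\<lambda>\<qq>. pair \<qq> y) ` elts Q"
      using y by (auto simp: R_def elts_uprod)
    then show ?thesis
      by (simp add: ll shriek_def Q \<phi>_def image_image)
  qed
  have "xiT \<T> X (least_limit X a \<pp>) \<xx> = xiT \<T> X (shriek R usnd \<phi>) \<xx>"
    using shriek t by (rule xiT_cong)
  also have "\<dots> = (SUP w\<in>{w \<in> elts (Tob \<T> R). Tmap \<T> R X usnd w = \<xx>}. xiT \<T> R \<phi> w)"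
    using xi_shriek[OF R_snd t] by (simp add: shriek_def)
  finally have *: "xiT \<T> X (least_limit X a \<pp>) \<xx> = \<dots>" .
  have "a \<xx> x * xiT \<T> R \<phi> w \<le> least_limit X a \<pp> x"
    if w: "w \<in> elts (Tob \<T> R)" and wt: "Tmap \<T> R X usnd w = \<xx>" for w
  proof -
    define W where "W = Tmap \<T> R ?TP ufst w"
    define WX where "WX = Tmap \<T> ?TP ?TX ?\<pi>2 W"
    have W: "W \<in> elts (Tob \<T> ?TP)"
      unfolding W_def by (rule Tmap_elts[OF R_fst w])
    have WX: "WX \<in> elts (Tob \<T> ?TX)"
      unfolding WX_def by (rule Tmap_elts[OF \<pi>2 W])
    have "xiT \<T> R \<phi> w =
        xiT \<T> R (\<lambda>z. a (?\<pi>2 (ufst z)) (usnd z)) w * xiT \<T> R (\<lambda>z. ?ev (ufst z)) w"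
      unfolding \<phi>_def by (rule xiT_times[OF w])
    moreover have "xiT \<T> R (\<lambda>z. ?ev (ufst z)) w = ?ev (mmult \<T> P W)"
      unfolding xiT_mmult[OF W] unfolding W_def by (rule xiT_Tmap[symmetric, OF R_fst w]) simp
    moreover have "xiT \<T> R (\<lambda>z. a (?\<pi>2 (ufst z)) (usnd z)) w \<le> Txi \<T> ?TX X a WX \<xx>"
    proof -
      let ?g = "\<lambda>z. pair (?\<pi>2 (ufst z)) (usnd z)"
      let ?w = "Tmap \<T> R (uprod ?TX X) ?g w"
      have g: "?g \<in> elts R \<rightarrow> elts (uprod ?TX X)"
        using R_fst R_snd \<pi>2 by (auto simp: Pi_iff)
      have "Tmap \<T> (uprod ?TX X) ?TX ufst ?w = Tmap \<T> R ?TX (\<lambda>z. ?\<pi>2 (ufst z)) w"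
        by (rule Tmap_Tmap[OF g _ w]) auto
      also have "\<dots> = WX"
        unfolding WX_def W_def by (rule Tmap_Tmap[symmetric, OF R_fst \<pi>2 w]) simp
      finally have "Tmap \<T> (uprod ?TX X) ?TX ufst ?w = WX" .
      moreover have "Tmap \<T> (uprod ?TX X) X usnd ?w = \<xx>"
        unfolding wt[symmetric] by (rule Tmap_Tmap[OF g _ w]) auto
      moreover have "xiT \<T> (uprod ?TX X) (\<lambda>z. a (ufst z) (usnd z)) ?w =
          xiT \<T> R (\<lambda>z. a (?\<pi>2 (ufst z)) (usnd z)) w"
        by (rule xiT_Tmap[OF g w]) simp
      ultimately show ?thesis
        unfolding Txi_def using Tmap_elts[OF g w] by (intro SUP_upper2[of ?w]) auto
    qed
    ultimately have "a \<xx> x * xiT \<T> R \<phi> w \<le> a \<xx> x * (Txi \<T> ?TX X a WX \<xx> * ?ev (mmult \<T> P W))"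
      by (simp add: times_mono)
    also have "\<dots> = (Txi \<T> ?TX X a WX \<xx> * a \<xx> x) * ?ev (mmult \<T> P W)"
      by (simp add: mult_ac)
    also have "\<dots> \<le> a (mmult \<T> X WX) x * ?ev (mmult \<T> P W)"
      using T_category_trans[OF cat WX t x] by (rule times_mono) simp
    also have "mmult \<T> X WX = ?\<pi>2 (mmult \<T> P W)"
      unfolding WX_def by (rule mmult_natural[symmetric, OF snd_in W])
    also have "a (?\<pi>2 (mmult \<T> P W)) x * ?ev (mmult \<T> P W) \<le> least_limit X a \<pp> x"
    proof -
      \<comment> \<open>Since \<open>T\<pi>\<^sub>1\<close> is constant at \<open>\<pp>\<close> on \<open>Q\<close>, it follows that \<open>TT\<pi>\<^sub>1(W) = e(\<pp>)\<close>.\<close>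
      have "Tmap \<T> ?TP (Tob \<T> E) ?\<pi>1 W = Tmap \<T> R (Tob \<T> E) (\<lambda>z. ?\<pi>1 (ufst z)) w"
        unfolding W_def by (rule Tmap_Tmap[OF R_fst \<pi>1 w]) simp
      also have "\<dots> = munit \<T> (Tob \<T> E) \<pp>"
        using p w by (intro Tmap_const[OF one]) (auto simp: E_def R_def elts_uprod Q)
      finally have "?\<pi>1 (mmult \<T> P W) = \<pp>"
        using p by (simp add: mmult_natural[OF fst_in W] mmult_munit E_def[symmetric])
      then show ?thesis
        unfolding ll using mmult_elts[OF W] by (intro SUP_upper) simp
    qed
    finally show ?thesis .
  qed
  then show ?thesis
    unfolding * times_SUP by (intro SUP_least) simp
qed

lemma ugraph_least_limit_in:
  assumes "is_singleton (elts (Tob \<T> uone))" "T_category \<T> X a"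
    and "\<pp> \<in> elts (Tob \<T> (exp_ob \<T> X a))"
  shows "ugraph X (vcode \<T> \<circ> least_limit X a \<pp>) \<in> elts (exp_ob \<T> X a)"
proof -
  have "vcode \<T> \<circ> least_limit X a \<pp> \<in> elts X \<rightarrow> elts (Vob \<T>)" by auto
  moreover have "vdecode \<T> \<circ> (vcode \<T> \<circ> least_limit X a \<pp>) = least_limit X a \<pp>" by auto
  ultimately have "T_functor \<T> X a (Vob \<T>) (V_struct \<T>) (vcode \<T> \<circ> least_limit X a \<pp>)"
    using least_limit_functor[OF assms] by (simp add: T_functor_Vob_iff)
  then show ?thesis by (auto simp: elts_exp_ob)
qed

section \<open>Dualisability of the exponential\<close>

lemma exp_struct_munit:
  assumes "T_category \<T> X a" "h \<in> elts (exp_ob \<T> X a)"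
  shows "exp_struct \<T> X a (munit \<T> (exp_ob \<T> X a) h) h' =
    (INF x\<in>elts X. qhom (vdecode \<T> (uapp h x)) (vdecode \<T> (uapp h' x)))"
  unfolding exp_struct_least_limit using assms by (intro INF_cong) (simp_all add: least_limit_munit)

lemma exp_dualisable:
  assumes one: "is_singleton (elts (Tob \<T> uone))" and cat: "T_category \<T> X a"
  shows "dualisable \<T> (exp_ob \<T> X a) (exp_struct \<T> X a)"
proof -
  define E where "E = exp_ob \<T> X a"
  define d where "d = exp_struct \<T> X a"
  define d0 where "d0 = rel_comp (Tob \<T> E) d (map_rel (munit \<T> E))"
  define \<alpha> where "\<alpha> \<pp> = ugraph X (vcode \<T> \<circ> least_limit X a \<pp>)" for \<pp>
  have d_munit: "d (munit \<T> E h) h' =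
      (INF x\<in>elts X. qhom (vdecode \<T> (uapp h x)) (vdecode \<T> (uapp h' x)))"
    if "h \<in> elts E" for h h'
    using exp_struct_munit[OF cat] that by (simp add: d_def E_def)
  then have d0: "d0 h h' = (INF x\<in>elts X. qhom (vdecode \<T> (uapp h x)) (vdecode \<T> (uapp h' x)))"
    if "h \<in> elts E" for h h'
    using that by (simp add: d0_def rel_comp_map_rel munit_elts)
  have "T_graph \<T> E d"
    by (auto simp: T_graph_def rel_le_def rel_conv_def map_rel_def d_munit le_INF_iff one_le_qhom)
  moreover have "rel_le E E (rel_comp E d0 d0) d0"
    unfolding rel_le_def
  proof (intro ballI)
    fix h h' assume h: "h \<in> elts E" and h': "h' \<in> elts E"
    show "rel_comp E d0 d0 h h' \<le> d0 h h'"
      unfolding rel_comp_def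
    proof (rule SUP_least)
      fix g assume g: "g \<in> elts E"
      have "d0 h g * d0 g h' \<le> qhom (vdecode \<T> (uapp h x)) (vdecode \<T> (uapp h' x))"
        if "x \<in> elts X" for x
      proof -
        have "d0 h g \<le> qhom (vdecode \<T> (uapp h x)) (vdecode \<T> (uapp g x))"
          "d0 g h' \<le> qhom (vdecode \<T> (uapp g x)) (vdecode \<T> (uapp h' x))"
          unfolding d0[OF h] d0[OF g] using that by (rule INF_lower)+
        from order_trans[OF times_mono[OF this] qhom_trans] show ?thesis .
      qed
      then show "d0 h g * d0 g h' \<le> d0 h h'"
        unfolding d0[OF h] by (rule INF_greatest)
    qed
  qed
  moreover have \<alpha>: "\<alpha> \<in> elts (Tob \<T> E) \<rightarrow> elts E"
    using ugraph_least_limit_in[OF one cat] by (simp add: \<alpha>_def E_def)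
  moreover have "rel_eq (Tob \<T> E) E d (rel_comp E d0 (map_rel \<alpha>))"
    unfolding rel_eq_def
  proof (intro ballI)
    fix \<pp> h assume "\<pp> \<in> elts (Tob \<T> E)"
    then have \<alpha>p: "\<alpha> \<pp> \<in> elts E" using \<alpha> by blast
    have "d \<pp> h = (INF x\<in>elts X. qhom (least_limit X a \<pp> x) (vdecode \<T> (uapp h x)))"
      by (simp add: d_def exp_struct_least_limit)
    also have "\<dots> = d0 (\<alpha> \<pp>) h"
      unfolding d0[OF \<alpha>p] by (intro INF_cong) (simp_all add: \<alpha>_def uapp_ugraph)
    also have "\<dots> = rel_comp E d0 (map_rel \<alpha>) \<pp> h"
      using \<alpha>p by (simp add: rel_comp_map_rel)
    finally show "d \<pp> h = rel_comp E d0 (map_rel \<alpha>) \<pp> h" .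
  qed
  ultimately show ?thesis
    unfolding dualisable_def Let_def d0_def E_def d_def by blast
qed

end

theorem lemma4p1:
  fixes \<T> :: "('u::set_universe, 'v::comm_quantale) top_theory"
    and X :: 'u and a :: "'u \<Rightarrow> 'u \<Rightarrow> 'v"
  assumes "topological_theory \<T>"
    and "(bot::'v) \<noteq> 1"
    and "is_singleton (elts (Tob \<T> uone))"
    and "T_category \<T> X a"
  shows "dualisable \<T> (exp_ob \<T> X a) (exp_struct \<T> X a)"
  using topological_theory.exp_dualisable[OF assms(1,3,4)] .

end
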